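(* For every integer $d \geq 2$ and every continuous function $f\colon[0,1]^d\to\mathbb{R}$ the following identity holds: $$\sup_{\mathbf{x}^1,\mathbf{x}^2,\ldots,\mathbf{x}^d \in \mathcal{U}} \ \limsup_{n \to \infty} \frac{1}{n} \sum_{i=1}^{n} f(x_i^1,x_i^2,\ldots,x_i^d) = \sup_{\vartheta \in \mathcal{P}_{\mathrm{ds}}([0,1]^d)} \int_{[0,1]^d} f \, \mathrm{d}\vartheta .$$
   Context: A sequence $(x_n)_{n\in\mathbb{N}}$ in $[0,1]$ is called uniformly distributed if for every interval $[a,b]\subseteq[0,1]$ one has $\lim_{n\to\infty}\frac1n\sum_{i=1}^n \mathbf{1}_{[a,b]}(x_i)=b-a$. $\mathcal{U}$ denotes the set of all uniformly distributed sequences in $[0,1]$; $x_i^j$ denotes the $i$-th element of the sequence $\mathbf{x}^j\in\mathcal{U}$. A Borel probability measure $\vartheta$ on $[0,1]^d$ is called $d$-stochastic if all its univariate marginals (push-forwards under the coordinate projections) equal the Lebesgue measure on $[0,1]$. $\mathcal{P}_{\mathrm{ds}}([0,1]^d)$ denotes the set of all $d$-stochastic measures on $[0,1]^d$. *)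

theory Defs
  imports "HOL-Probability.Probability"
begin

text \<open>
  The cube \<open>[0,1]\<^sup>d\<close> lives in \<^typ>\<open>real ^ 'd\<close> with \<open>d = CARD('d)\<close>.
  Sequences are indexed from 0, so that the sum over \<open>i < n\<close> ranges over the first \<open>n\<close> elements.
\<close>

abbreviation unit_cube :: "(real ^ 'd::finite) set" where
  "unit_cube \<equiv> cbox 0 1"

definition uniformly_distributed :: "(nat \<Rightarrow> real) \<Rightarrow> bool" where
  "uniformly_distributed x \<longleftrightarrow>
     range x \<subseteq> {0..1} \<and>
     (\<forall>a b. 0 \<le> a \<and> a \<le> b \<and> b \<le> 1 \<longrightarrow>
        (\<lambda>n. 1 / real n * (\<Sum>i<n. indicator {a..b} (x i))) \<longlonglongrightarrow> b - a)"

definition UD :: "(nat \<Rightarrow> real) set" where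
  "UD = {x. uniformly_distributed x}"

text \<open>The underlying space of a \<open>d\<close>-stochastic measure is the cube itself, with its Borel sets.\<close>

definition d_stochastic :: "(real ^ 'd::finite) measure \<Rightarrow> bool" where
  "d_stochastic \<theta> \<longleftrightarrow>
     prob_space \<theta> \<and>
     sets \<theta> = sets (restrict_space borel unit_cube) \<and>
     (\<forall>j. distr \<theta> (restrict_space borel {0..1}) (\<lambda>x. x $ j) = restrict_space lborel {0..1})"

definition P_ds :: "(real ^ 'd::finite) measure set" where
  "P_ds = {\<theta>. d_stochastic \<theta>}"

end

theory Submission
  imports Defs
begin

text \<open>
  Each inequality comes from an explicit construction: of sequences from a measure, and of a
  measure from finitely many terms of the sequences.

  For \<open>\<ge>\<close>, every \<open>d\<close>-stochastic \<open>\<theta>\<close> has a sequence of points in the cube along which the averages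
  of \<open>f\<close> converge to its integral and whose coordinates are uniformly distributed
  (\<open>ex_uniformly_distributed_averages_converge\<close>). Independent samples from \<open>\<theta>\<close> would almost surely
  do this. A greedy choice does it surely: given finitely many points, the next one is chosen so
  that a weighted sum of squared discrepancies, over a countable family of test functions, increases
  by at most a constant (\<open>ex_sequence_small_sums\<close>). Discrepancies of order \<open>sqrt n\<close> result. The family
  consists of \<open>f\<close> and the indicators of the half-spaces \<open>y $ j \<le> q\<close> for rational \<open>q\<close>.

  For \<open>\<le>\<close>, the average of \<open>f\<close> over the first \<open>N\<close> points is, for large \<open>N\<close>, at most \<open>\<epsilon>\<close> above the
  integral of \<open>f\<close> against a \<open>d\<close>-stochastic measure (\<open>ex_d_stochastic_near_average\<close>).
  In each coordinate \<open>j\<close> the ranks of the first \<open>N\<close> terms form a permutation of \<open>{..<N}\<close>, and it defines an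
  exchange \<open>T\<^sub>j\<close> of the \<open>N\<close> equal subintervals of \<open>[0, 1)\<close> that preserves Lebesgue measure. The measure
  sought is the law of \<open>(T\<^sub>1 u, ..., T\<^sub>d u)\<close> for uniform \<open>u\<close>. Uniform distribution makes rank over \<open>N\<close>
  close to the term itself (\<open>lex_rank_approximates\<close>), so for \<open>u\<close> in the \<open>i\<close>-th subinterval this vector is
  close to the \<open>i\<close>-th point.
\<close>

section \<open>Greedy sequences with small discrepancy\<close>

lemma (in prob_space) ex_le_expectation:
  fixes h :: "'a \<Rightarrow> real"
  assumes "integrable M h"
  shows "\<exists>y\<in>space M. h y \<le> expectation h"
proof (rule ccontr)
  assume "\<not> ?thesis"
  then have "AE y in M. expectation h < h y"
    by (auto intro!: AE_I2 simp: not_le)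
  then have "expectation h < expectation h"
    using expectation_greater[OF assms] by blast
  then show False by simp
qed

text \<open>
  A derandomised law of large numbers. For independent samples \<open>y i\<close> the partial sums of a centred,
  bounded \<open>g m\<close> have variance at most \<open>n\<close>, because the cross terms have mean zero. Here the next
  point is instead chosen greedily: the weighted cross term is, as a function of the next point,
  a linear combination of the \<open>g m\<close> and so has mean zero, and some point makes it nonpositive.
  The weighted sum of the squared partial sums then grows at most linearly, for all \<open>m\<close> at once.
\<close>
lemma (in prob_space) ex_sequence_small_sums:
  fixes g :: "nat \<Rightarrow> 'a \<Rightarrow> real"
  assumes meas: "\<And>m. g m \<in> borel_measurable M"
    and bound: "\<And>m y. y \<in> space M \<Longrightarrow> \<bar>g m y\<bar> \<le> 1"
    and zero: "\<And>m. expectation (g m) = 0"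
  shows "\<exists>y. (\<forall>i. y i \<in> space M) \<and>
           (\<forall>m n. m < n \<longrightarrow> (\<Sum>i<n. g m (y i))\<^sup>2 \<le> 3 * 4 ^ m * real n)"
proof -
  have int: "integrable M (g m)" for m
    by (rule integrable_const_bound[of _ 1]) (auto intro!: AE_I2 meas bound)
  \<comment> \<open>Only the functions of index at most \<open>n\<close> enter step \<open>n\<close>, so that every sum stays finite.\<close>
  define P where "P y n r \<longleftrightarrow> r \<in> space M \<and>
      (\<Sum>m\<le>n. (1/4) ^ m * (\<Sum>i<n. g m (y i)) * g m r) \<le> 0"
    for y :: "nat \<Rightarrow> 'a" and n r
  have "\<exists>y. \<forall>n. P y n (y n)"
  proof (rule dependent_wf_choice[of less_than])
    show "P y n r = P y' n r" if "\<And>z. (z, n) \<in> less_than \<Longrightarrow> y z = y' z" for y y' n r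
      using that by (simp add: P_def)
    show "\<exists>r. P y n r" for n y
    proof -
      let ?h = "\<lambda>r. \<Sum>m\<le>n. (1/4) ^ m * (\<Sum>i<n. g m (y i)) * g m r"
      have "integrable M ?h" using int by simp
      then have "\<exists>r\<in>space M. ?h r \<le> expectation ?h" by (rule ex_le_expectation)
      also have "expectation ?h = 0" using int zero by simp
      finally show ?thesis by (auto simp: P_def)
    qed
  qed simp
  then obtain y where y: "\<And>n. P y n (y n)" by blast
  have ysp: "y i \<in> space M" for i using y[of i] by (simp add: P_def)
  define S where "S m n = (\<Sum>i<n. g m (y i))" for m n
  have S_Suc: "S m (Suc n) = S m n + g m (y n)" for m n by (simp add: S_def)
  have S_bound: "(S m n)\<^sup>2 \<le> (real n)\<^sup>2" for m n
  proof -
    have "\<bar>S m n\<bar> \<le> (\<Sum>i<n. \<bar>g m (y i)\<bar>)" unfolding S_def by (rule sum_abs)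
    also have "\<dots> \<le> (\<Sum>i<n. 1)" by (intro sum_mono bound ysp)
    finally show ?thesis by (simp add: abs_le_square_iff[symmetric])
  qed
  \<comment> \<open>The weight \<open>1/4 ^ m\<close> is small enough that the function of index \<open>n\<close>, which enters the potential
    at step \<open>n\<close> with a partial sum that may be as large as \<open>n\<close>, adds at most 1 to it.\<close>
  define Q where "Q n = (\<Sum>m<n. (1/4) ^ m * (S m n)\<^sup>2)" for n
  have Q_bound: "Q n \<le> 3 * real n" for n
  proof (induction n)
    case 0
    show ?case by (simp add: Q_def)
  next
    case (Suc n)
    have "Q (Suc n) = (\<Sum>m\<le>n. (1/4) ^ m * (S m n)\<^sup>2 +
            2 * ((1/4) ^ m * S m n * g m (y n)) + (1/4) ^ m * (g m (y n))\<^sup>2)"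
      unfolding Q_def S_Suc lessThan_Suc_atMost
      by (intro sum.cong refl) (simp add: power2_eq_square algebra_simps)
    also have "\<dots> = (\<Sum>m\<le>n. (1/4) ^ m * (S m n)\<^sup>2) +
        2 * (\<Sum>m\<le>n. (1/4) ^ m * S m n * g m (y n)) +
        (\<Sum>m\<le>n. (1/4) ^ m * (g m (y n))\<^sup>2)"
      by (simp add: sum.distrib sum_distrib_left)
    also have "(\<Sum>m\<le>n. (1/4) ^ m * (S m n)\<^sup>2) = Q n + (1/4) ^ n * (S n n)\<^sup>2"
      by (simp add: Q_def lessThan_Suc_atMost[symmetric])
    also have "(1/4) ^ n * (S n n)\<^sup>2 \<le> 1"
    proof -
      have "real n \<le> 2 ^ n" using less_exp[of n] by (metis less_imp_le of_nat_le_iff of_nat_power of_nat_numeral)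
      then have "(real n)\<^sup>2 \<le> (2 ^ n)\<^sup>2" by (intro power_mono) auto
      also have "(2 ^ n)\<^sup>2 = (4::real) ^ n" by (simp add: power2_eq_square flip: power_mult_distrib)
      finally show ?thesis using S_bound[of n n]
        by (simp add: power_divide divide_simps)
    qed
    also have "(\<Sum>m\<le>n. (1/4) ^ m * S m n * g m (y n)) \<le> 0"
      using y[of n] by (simp add: P_def S_def)
    also have "(\<Sum>m\<le>n. (1/4) ^ m * (g m (y n))\<^sup>2) \<le> 2"
    proof -
      have "(\<Sum>m\<le>n. (1/4) ^ m * (g m (y n))\<^sup>2) \<le> (\<Sum>m\<le>n. (1/4::real) ^ m)"
        using bound[OF ysp] by (intro sum_mono mult_left_le) (auto simp: abs_square_le_1)
      also have "\<dots> \<le> 2"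
        by (simp add: lessThan_Suc_atMost[symmetric] sum_gp_strict del: sum.lessThan_Suc)
          (rule order_trans[of _ 0]; simp)
      finally show ?thesis .
    qed
    finally show ?case using Suc.IH by simp
  qed
  have "(\<Sum>i<n. g m (y i))\<^sup>2 \<le> 3 * 4 ^ m * real n" if "m < n" for m n
  proof -
    have "(1/4) ^ m * (S m n)\<^sup>2 \<le> Q n"
      unfolding Q_def using that by (intro member_le_sum) auto
    also have "\<dots> \<le> 3 * real n" by (rule Q_bound)
    finally show ?thesis by (simp add: S_def power_divide field_simps)
  qed
  with ysp show ?thesis by blast
qed

text \<open>
  Enumerate the functions, centre them and scale them into \<open>[-1, 1]\<close>: partial sums of order \<open>sqrt n\<close>
  then mean that the averages tend to the expectations.
\<close>
lemma (in prob_space) ex_sequence_averages_converge: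
  fixes G :: "('a \<Rightarrow> real) set"
  assumes "countable G"
    and meas: "\<And>g. g \<in> G \<Longrightarrow> g \<in> borel_measurable M"
    and bdd: "\<And>g. g \<in> G \<Longrightarrow> \<exists>B. \<forall>y\<in>space M. \<bar>g y\<bar> \<le> B"
  shows "\<exists>y. (\<forall>i. y i \<in> space M) \<and>
           (\<forall>g\<in>G. (\<lambda>n. 1 / real n * (\<Sum>i<n. g (y i))) \<longlonglongrightarrow> expectation g)"
proof -
  \<comment> \<open>The zero function is added because only a nonempty set can be enumerated.\<close>
  define G' where "G' = insert (\<lambda>_. 0) G"
  define e where "e = from_nat_into G'"
  have G': "countable G'" "G' \<noteq> {}" using assms(1) by (auto simp: G'_def)
  have e: "e m \<in> G'" for m unfolding e_def by (rule from_nat_into[OF G'(2)])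
  have meas': "e m \<in> borel_measurable M" for m using e[of m] meas by (auto simp: G'_def)
  have "\<exists>B. \<forall>y\<in>space M. \<bar>e m y\<bar> \<le> B" for m using e[of m] bdd by (auto simp: G'_def)
  then obtain B where B: "\<And>m y. y \<in> space M \<Longrightarrow> \<bar>e m y\<bar> \<le> B m" by metis
  have int: "integrable M (e m)" for m
    by (rule integrable_const_bound[of _ "B m"]) (auto intro!: AE_I2 meas' B)
  have Bexp: "\<bar>expectation (e m)\<bar> \<le> B m" for m
  proof -
    have "\<bar>expectation (e m)\<bar> \<le> expectation (\<lambda>y. \<bar>e m y\<bar>)" by simp
    also have "\<dots> \<le> expectation (\<lambda>_. B m)" using int B by (intro integral_mono) auto
    finally show ?thesis by (simp add: prob_space)
  qed
  define C where "C m = 2 * B m + 1" for m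
  have Cpos: "C m > 0" for m using Bexp[of m] by (simp add: C_def)
  define h where "h m y = (e m y - expectation (e m)) / C m" for m y
  have "\<exists>y. (\<forall>i. y i \<in> space M) \<and>
           (\<forall>m n. m < n \<longrightarrow> (\<Sum>i<n. h m (y i))\<^sup>2 \<le> 3 * 4 ^ m * real n)"
  proof (rule ex_sequence_small_sums)
    show "h m \<in> borel_measurable M" for m unfolding h_def using meas' by measurable
    show "\<bar>h m y\<bar> \<le> 1" if "y \<in> space M" for m y
      using B[OF that, of m] Bexp[of m] Cpos[of m] by (simp add: h_def C_def abs_le_iff divide_simps)
    show "expectation (h m) = 0" for m
      unfolding h_def using int by (simp add: prob_space)
  qed
  then obtain y where ysp: "\<And>i. y i \<in> space M"
    and y: "\<And>m n. m < n \<Longrightarrow> (\<Sum>i<n. h m (y i))\<^sup>2 \<le> 3 * 4 ^ m * real n" by blast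
  have lim: "(\<lambda>n. 1 / real n * (\<Sum>i<n. e m (y i))) \<longlonglongrightarrow> expectation (e m)" for m
  proof -
    define K where "K = sqrt (3 * 4 ^ m)"
    have "(\<lambda>n. 1 / real n * (\<Sum>i<n. h m (y i))) \<longlonglongrightarrow> 0"
    proof (rule Lim_null_comparison)
      have "norm (1 / real n * (\<Sum>i<n. h m (y i))) \<le> K / sqrt (real n)" if n: "m < n" for n
      proof -
        have "\<bar>\<Sum>i<n. h m (y i)\<bar> \<le> K * sqrt (real n)"
          using real_sqrt_le_mono[OF y[OF n]] by (simp add: K_def real_sqrt_mult)
        then have "\<bar>\<Sum>i<n. h m (y i)\<bar> / real n \<le> K * sqrt (real n) / real n"
          by (rule divide_right_mono) simp
        also have "\<dots> = K / sqrt (real n)" using n by (simp add: divide_simps)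
        finally show ?thesis by (simp add: abs_mult)
      qed
      then show "\<forall>\<^sub>F n in sequentially. norm (1 / real n * (\<Sum>i<n. h m (y i))) \<le> K / sqrt (real n)"
        by (rule eventually_mono[OF eventually_gt_at_top[of m]])
      show "(\<lambda>n. K / sqrt (real n)) \<longlonglongrightarrow> 0"
        by (intro tendsto_divide_0[OF tendsto_const] filterlim_at_top_imp_at_infinity
            filterlim_compose[OF sqrt_at_top] filterlim_real_sequentially)
    qed
    then have "(\<lambda>n. C m * (1 / real n * (\<Sum>i<n. h m (y i))) + expectation (e m)) \<longlonglongrightarrow>
        C m * 0 + expectation (e m)"
      by (intro tendsto_intros)
    moreover have "C m * (1 / real n * (\<Sum>i<n. h m (y i))) + expectation (e m) =
        1 / real n * (\<Sum>i<n. e m (y i))" if "n > 0" for n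
    proof -
      have "C m * (\<Sum>i<n. h m (y i)) = (\<Sum>i<n. e m (y i)) - real n * expectation (e m)"
        using Cpos[of m] by (simp add: h_def sum_divide_distrib[symmetric] sum_subtractf)
      then show ?thesis using that by (simp add: field_simps)
    qed
    then have "\<forall>\<^sub>F n in sequentially. C m * (1 / real n * (\<Sum>i<n. h m (y i))) + expectation (e m) =
        1 / real n * (\<Sum>i<n. e m (y i))"
      by (rule eventually_mono[OF eventually_gt_at_top[of 0]])
    ultimately show ?thesis by (simp add: tendsto_cong)
  qed
  have "\<exists>m. g = e m" if "g \<in> G" for g
    using from_nat_into_surj[OF G'(1), of g] that by (auto simp: e_def G'_def)
  with lim ysp show ?thesis by blast
qed

section \<open>From measures to uniformly distributed sequences\<close>

text \<open>
  Countably many frequencies control all of them: the indicator of \<open>{a..b}\<close> lies between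
  differences of indicators of rational half-lines \<open>{..q} - {..r}\<close>, with \<open>q\<close> near \<open>b\<close> and \<open>r\<close> near
  \<open>a\<close>. Half-lines that end outside \<open>[0, 1]\<close> are included, so that \<open>a = 0\<close> and \<open>b = 1\<close>
  are not special.
\<close>
lemma uniformly_distributed_rational_cdf:
  assumes "range x \<subseteq> {0..1}"
    and cdf: "\<And>q. q \<in> \<rat> \<Longrightarrow>
      (\<lambda>n. 1 / real n * (\<Sum>i<n. indicator {..q} (x i))) \<longlonglongrightarrow> max 0 (min 1 q)"
  shows "uniformly_distributed x"
  unfolding uniformly_distributed_def
proof (intro conjI allI impI assms(1))
  fix a b :: real
  assume ab: "0 \<le> a \<and> a \<le> b \<and> b \<le> 1"
  let ?F = "\<lambda>A n. 1 / real n * (\<Sum>i<n. indicator A (x i) :: real)"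
  have diff: "(\<lambda>n. ?F {..q} n - ?F {..r} n) \<longlonglongrightarrow> max 0 (min 1 q) - max 0 (min 1 r)"
    if "q \<in> \<rat>" "r \<in> \<rat>" for q r using that by (intro tendsto_diff cdf)
  have mono: "?F A n - ?F B n \<le> ?F C n - ?F D n"
    if "\<And>y. indicator A y - indicator B y \<le> (indicator C y - indicator D y :: real)" for A B C D n
    unfolding right_diff_distrib[symmetric] sum_subtractf[symmetric]
    using that by (intro mult_left_mono sum_mono) auto
  show "(\<lambda>n. ?F {a..b} n) \<longlonglongrightarrow> b - a"
  proof (rule order_tendstoI)
    fix l assume "l < b - a"
    define \<epsilon> where "\<epsilon> = (b - a - l) / 2"
    have "\<epsilon> > 0" using \<open>l < b - a\<close> by (simp add: \<epsilon>_def)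
    obtain q where q: "q \<in> \<rat>" "b - \<epsilon> < q" "q < b"
      using Rats_dense_in_real[of "b - \<epsilon>" b] \<open>\<epsilon> > 0\<close> by auto
    obtain r where r: "r \<in> \<rat>" "a < r" "r < a + \<epsilon>"
      using Rats_dense_in_real[of a "a + \<epsilon>"] \<open>\<epsilon> > 0\<close> by auto
    have "l < max 0 (min 1 q) - max 0 (min 1 r)"
      using q r ab by (simp add: \<epsilon>_def field_simps)
    from order_tendstoD(1)[OF diff[OF q(1) r(1)] this]
    show "\<forall>\<^sub>F n in sequentially. l < ?F {a..b} n"
    proof eventually_elim
      case (elim n)
      also have "?F {..q} n - ?F {..r} n \<le> ?F {a..b} n - ?F {} n"
        using q r by (intro mono) (auto simp: indicator_def)
      finally show ?case by simp
    qed
  next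
    fix l assume "b - a < l"
    define \<epsilon> where "\<epsilon> = (l - (b - a)) / 2"
    have "\<epsilon> > 0" using \<open>b - a < l\<close> by (simp add: \<epsilon>_def)
    obtain q where q: "q \<in> \<rat>" "b < q" "q < b + \<epsilon>"
      using Rats_dense_in_real[of b "b + \<epsilon>"] \<open>\<epsilon> > 0\<close> by auto
    obtain r where r: "r \<in> \<rat>" "a - \<epsilon> < r" "r < a"
      using Rats_dense_in_real[of "a - \<epsilon>" a] \<open>\<epsilon> > 0\<close> by auto
    have "max 0 (min 1 q) - max 0 (min 1 r) < l"
      using q r ab by (simp add: \<epsilon>_def field_simps)
    from order_tendstoD(2)[OF diff[OF q(1) r(1)] this]
    show "\<forall>\<^sub>F n in sequentially. ?F {a..b} n < l"
    proof eventually_elim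
      case (elim n)
      have "?F {a..b} n - ?F {} n \<le> ?F {..q} n - ?F {..r} n"
        using q r ab by (intro mono) (auto simp: indicator_def)
      then show ?case using elim by simp
    qed
  qed
qed

lemma space_d_stochastic: "d_stochastic \<theta> \<Longrightarrow> space \<theta> = unit_cube"
  unfolding d_stochastic_def by (metis sets_eq_imp_space_eq space_restrict_space space_borel Int_UNIV_right)

lemma borel_measurable_d_stochastic:
  fixes f :: "real ^ 'd::finite \<Rightarrow> real"
  assumes "d_stochastic \<theta>" "f \<in> borel_measurable (restrict_space borel unit_cube)"
  shows "f \<in> borel_measurable \<theta>"
  using assms by (simp add: d_stochastic_def cong: measurable_cong_sets)

lemma continuous_on_unit_cube_bounded:
  fixes f :: "real ^ 'd::finite \<Rightarrow> real"
  assumes "continuous_on unit_cube f"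
  shows "\<exists>B. \<forall>y\<in>unit_cube. \<bar>f y\<bar> \<le> B"
proof -
  have "bounded (f ` unit_cube)"
    by (rule compact_imp_bounded[OF compact_continuous_image[OF assms compact_cbox]])
  then show ?thesis by (auto simp: bounded_iff)
qed

lemma integral_coordinate_cdf:
  fixes \<theta> :: "(real ^ 'd::finite) measure"
  assumes "d_stochastic \<theta>"
  shows "(\<integral>y. indicator {y. y $ j \<le> q} y \<partial>\<theta>) = max 0 (min 1 q)"
proof -
  have marg: "distr \<theta> (restrict_space borel {0..1}) (\<lambda>x. x $ j) = restrict_space lborel {0..1}"
    using assms by (simp add: d_stochastic_def)
  have meas: "(\<lambda>x. x $ j) \<in> measurable \<theta> (restrict_space borel {0..1})"
  proof (rule measurable_restrict_space2)
    show "(\<lambda>x. x $ j) \<in> space \<theta> \<rightarrow> {0..1}"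
      using space_d_stochastic[OF assms] by (auto simp: mem_box_cart)
    show "(\<lambda>x. x $ j) \<in> borel_measurable \<theta>"
      by (intro borel_measurable_d_stochastic[OF assms] borel_measurable_continuous_on_restrict
          continuous_intros)
  qed
  have "(\<integral>y. indicator {y. y $ j \<le> q} y \<partial>\<theta>) = (\<integral>y. (indicator {..q} (y $ j) :: real) \<partial>\<theta>)"
    by (intro Bochner_Integration.integral_cong refl) (simp add: indicator_def)
  also have "\<dots> = (\<integral>t. indicator {..q} t \<partial>restrict_space lborel {0..1})"
    unfolding marg[symmetric]
    by (subst integral_distr[OF meas]) (auto intro: measurable_restrict_space1)
  also have "\<dots> = (\<integral>t. indicator {0..1} t *\<^sub>R indicator {..q} t \<partial>lborel)"
    by (rule integral_restrict_space) simp
  also have "(\<lambda>t. indicator {0..1} t *\<^sub>R indicator {..q} t) =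
      (indicator {0..min 1 q} :: real \<Rightarrow> real)"
    by (auto simp: indicator_def fun_eq_iff)
  also have "(\<integral>t. indicator {0..min 1 q} t \<partial>lborel) = max 0 (min 1 q)"
    by (auto simp: measure_def emeasure_lborel_Icc_eq)
  finally show ?thesis .
qed

text \<open>
  Apply the derandomised law of large numbers to \<open>f\<close> and the indicators of the half-spaces
  \<open>y $ j \<le> q\<close> with rational \<open>q\<close>. The marginals of \<open>\<theta>\<close> being uniform, the latter make each
  coordinate sequence uniformly distributed.
\<close>
lemma ex_uniformly_distributed_averages_converge:
  fixes f :: "real ^ 'd::finite \<Rightarrow> real"
  assumes cont: "continuous_on unit_cube f" and \<theta>: "d_stochastic \<theta>"
  shows "\<exists>x. (\<forall>j. x j \<in> UD) \<and>
    (\<lambda>n. 1 / real n * (\<Sum>i<n. f (\<chi> j. x j i))) \<longlonglongrightarrow> integral\<^sup>L \<theta> f"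
proof -
  interpret prob_space \<theta> using \<theta> by (simp add: d_stochastic_def)
  define cdf where "cdf = (\<lambda>(j::'d, q::real). indicator {y :: real ^ 'd. y $ j \<le> q} :: _ \<Rightarrow> real)"
  let ?G = "insert f (cdf ` (UNIV \<times> \<rat>))"
  have "\<exists>y. (\<forall>i. y i \<in> space \<theta>) \<and>
      (\<forall>g\<in>?G. (\<lambda>n. 1 / real n * (\<Sum>i<n. g (y i))) \<longlonglongrightarrow> expectation g)"
  proof (rule ex_sequence_averages_converge)
    show "countable ?G"
      by (intro countable_insert countable_image countable_SIGMA countable_rat) (simp add: countable_finite)
    fix g assume "g \<in> ?G"
    then consider "g = f" | j q where "g = cdf (j, q)" by auto
    then have "g \<in> borel_measurable (restrict_space borel unit_cube) \<and>
        (\<exists>B. \<forall>y\<in>unit_cube. \<bar>g y\<bar> \<le> B)"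
    proof cases
      case 1
      then show ?thesis
        using borel_measurable_continuous_on_restrict[OF cont]
          continuous_on_unit_cube_bounded[OF cont] by blast
    next
      case 2
      have "closed {y :: real ^ 'd. y $ j \<le> q}"
        by (intro closed_Collect_le continuous_intros)
      then have "g \<in> borel_measurable (restrict_space borel unit_cube)"
        unfolding 2 cdf_def prod.case
        by (intro measurable_restrict_space1[OF borel_measurable_indicator[OF borel_closed]])
      moreover have "\<bar>g y\<bar> \<le> 1" for y by (simp add: 2 cdf_def indicator_def)
      ultimately show ?thesis by blast
    qed
    then show "g \<in> borel_measurable \<theta>" "\<exists>B. \<forall>y\<in>space \<theta>. \<bar>g y\<bar> \<le> B"
      unfolding space_d_stochastic[OF \<theta>] by (blast intro: borel_measurable_d_stochastic[OF \<theta>])+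
  qed
  then obtain y where y: "\<And>i. y i \<in> unit_cube"
    and lim: "\<And>g. g \<in> ?G \<Longrightarrow> (\<lambda>n. 1 / real n * (\<Sum>i<n. g (y i))) \<longlonglongrightarrow> expectation g"
    unfolding space_d_stochastic[OF \<theta>] by blast
  have "(\<lambda>i. y i $ j) \<in> UD" for j
    unfolding UD_def mem_Collect_eq
  proof (rule uniformly_distributed_rational_cdf)
    show "range (\<lambda>i. y i $ j) \<subseteq> {0..1}" using y by (auto simp: mem_box_cart)
    fix q :: real assume "q \<in> \<rat>"
    then have "cdf (j, q) \<in> ?G" by auto
    moreover have "expectation (cdf (j, q)) = max 0 (min 1 q)"
      unfolding cdf_def prod.case by (rule integral_coordinate_cdf[OF \<theta>])
    moreover have "cdf (j, q) (y i) = indicator {..q} (y i $ j)" for i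
      by (simp add: cdf_def indicator_def)
    ultimately show "(\<lambda>n. 1 / real n * (\<Sum>i<n. indicator {..q} (y i $ j))) \<longlonglongrightarrow> max 0 (min 1 q)"
      using lim[of "cdf (j, q)"] by simp
  qed
  moreover have "(\<lambda>n. 1 / real n * (\<Sum>i<n. f (\<chi> j. y i $ j))) \<longlonglongrightarrow> expectation f"
    using lim[of f] by simp
  ultimately show ?thesis by (intro exI[of _ "\<lambda>j i. y i $ j"]) auto
qed

section \<open>Ranks of uniformly distributed sequences\<close>

text \<open>
  Ties are broken by the index, which makes the rank injective even where \<open>x\<close> repeats a value.
\<close>
definition lex_rank :: "(nat \<Rightarrow> real) \<Rightarrow> nat \<Rightarrow> nat \<Rightarrow> nat" where
  "lex_rank x N i = card {k. k < N \<and> (x k < x i \<or> x k = x i \<and> k < i)}"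

lemma bij_betw_lex_rank: "bij_betw (lex_rank x N) {..<N} {..<N}"
proof -
  let ?L = "\<lambda>i. {k. k < N \<and> (x k < x i \<or> x k = x i \<and> k < i)}"
  have less: "lex_rank x N i < lex_rank x N i'"
    if "x i < x i' \<or> x i = x i' \<and> i < i'" "i < N" for i i'
    unfolding lex_rank_def using that by (intro psubset_card_mono) auto
  have "inj_on (lex_rank x N) {..<N}"
  proof (rule inj_onI)
    fix i i' assume i: "i \<in> {..<N}" "i' \<in> {..<N}" and eq: "lex_rank x N i = lex_rank x N i'"
    show "i = i'"
      using less[of i i'] less[of i' i] i eq by (metis lessThan_iff linorder_neqE less_irrefl)
  qed
  moreover have "lex_rank x N i < N" if "i < N" for i
  proof -
    have "?L i \<subset> {..<N}" using that by auto
    then have "card (?L i) < card {..<N}" by (rule psubset_card_mono[OF finite_lessThan])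
    then show ?thesis by (simp add: lex_rank_def)
  qed
  then have "lex_rank x N ` {..<N} \<subseteq> {..<N}" by auto
  ultimately show ?thesis
    by (simp add: bij_betw_def endo_inj_surj)
qed

text \<open>
  The rank of \<open>x i\<close> lies between the number of the first \<open>N\<close> terms below \<open>x i\<close> and the number of those
  up to \<open>x i\<close>; both are about \<open>N * x i\<close>. The bound is uniform in \<open>i\<close> because
  the frequencies of the finitely many intervals \<open>[0, m/K]\<close> converge simultaneously and
  every \<open>x i\<close> is within \<open>1/K\<close> of such an endpoint.
\<close>
lemma lex_rank_approximates:
  assumes "uniformly_distributed x" and "\<eta> > 0"
  shows "\<forall>\<^sub>F N in sequentially. \<forall>i<N. \<bar>real (lex_rank x N i) / real N - x i\<bar> \<le> \<eta>"
proof -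
  obtain K :: nat where K: "K > 0" "1 / real K < \<eta> / 2"
    using nat_approx_posE[of "\<eta> / 2"] \<open>\<eta> > 0\<close> by (metis half_gt_zero zero_less_Suc)
  have x01: "0 \<le> x i" "x i \<le> 1" for i
    using assms(1) by (auto simp: uniformly_distributed_def image_subset_iff)
  have freq: "(\<lambda>n. 1 / real n * (\<Sum>i<n. indicator {0..t} (x i))) \<longlonglongrightarrow> t" if "0 \<le> t" "t \<le> 1" for t
    using assms(1) that unfolding uniformly_distributed_def by (metis diff_zero order_refl)
  have sum_card: "(\<Sum>i<n. indicator {0..t} (x i)) = real (card {k. k < n \<and> x k \<le> t})" for n t
  proof -
    have "(\<Sum>i<n. indicator {0..t} (x i)) = (\<Sum>i<n. if x i \<le> t then 1 else (0::real))"
      using x01 by (intro sum.cong) (auto simp: indicator_def)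
    also have "\<dots> = real (card {k. k < n \<and> x k \<le> t})"
      by (subst sum.inter_filter[symmetric]) auto
    finally show ?thesis .
  qed
  have "\<forall>\<^sub>F N in sequentially. \<forall>m\<in>{..K}.
      \<bar>1 / real N * real (card {k. k < N \<and> x k \<le> real m / real K}) - real m / real K\<bar> < \<eta> / 2"
  proof (rule eventually_ball_finite)
    show "\<forall>m\<in>{..K}. \<forall>\<^sub>F N in sequentially.
      \<bar>1 / real N * real (card {k. k < N \<and> x k \<le> real m / real K}) - real m / real K\<bar> < \<eta> / 2"
    proof
      fix m assume "m \<in> {..K}"
      then have "0 \<le> real m / real K" "real m / real K \<le> 1" using K by auto
      from tendstoD[OF freq[OF this], of "\<eta> / 2"]
      show "\<forall>\<^sub>F N in sequentially.
        \<bar>1 / real N * real (card {k. k < N \<and> x k \<le> real m / real K}) - real m / real K\<bar> < \<eta> / 2"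
        using \<open>\<eta> > 0\<close> by (simp add: dist_real_def sum_card)
    qed
  qed simp
  then show ?thesis
  proof eventually_elim
    case (elim N)
    show ?case
    proof (intro allI impI)
      fix i assume "i < N"
      then have N: "N > 0" by simp
      \<comment> \<open>The grid points next to \<open>x i\<close>: \<open>(m - 1) / K < x i \<le> m / K\<close>. The case \<open>m = 0\<close>, where there is
        no lower one, only occurs for \<open>x i = 0\<close>.\<close>
      define m where "m = nat \<lceil>real K * x i\<rceil>"
      have m_real: "real m = of_int \<lceil>real K * x i\<rceil>"
        using x01(1)[of i] by (simp add: m_def)
      have m: "real K * x i \<le> real m" "real m < real K * x i + 1"
        unfolding m_real by linarith+
      have "real K * x i \<le> real K" using x01(2)[of i] by (simp add: mult_left_le)
      then have "m \<le> K" using m(2) by linarith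
      have x_le: "x i \<le> real m / real K" using m(1) K by (simp add: field_simps)
      then have "lex_rank x N i \<le> card {k. k < N \<and> x k \<le> real m / real K}"
        unfolding lex_rank_def by (intro card_mono) auto
      then have "real (lex_rank x N i) / real N \<le>
          1 / real N * real (card {k. k < N \<and> x k \<le> real m / real K})"
        by (simp add: divide_right_mono)
      also have "\<dots> < real m / real K + \<eta> / 2" using elim[rule_format, unfolded atMost_iff, OF \<open>m \<le> K\<close>] by linarith
      also have "real m / real K \<le> x i + 1 / real K" using m(2) K by (simp add: field_simps)
      finally have upper: "real (lex_rank x N i) / real N - x i \<le> \<eta>" using K by simp
      have lower: "x i - real (lex_rank x N i) / real N \<le> \<eta>"
      proof (cases "m = 0")
        case True
        then have "x i \<le> 0" using m(1) K by (simp add: mult_le_0_iff)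
        moreover have "0 \<le> real (lex_rank x N i) / real N" by simp
        ultimately show ?thesis using \<open>\<eta> > 0\<close> by linarith
      next
        case False
        then obtain m' where m': "m = Suc m'" by (cases m) auto
        have "x i - 1 / real K \<le> real m' / real K"
          using x_le by (simp add: m' add_divide_distrib)
        then have "x i - 1 / real K - \<eta> / 2 \<le> real m' / real K - \<eta> / 2" by simp
        also have "\<dots> \<le> 1 / real N * real (card {k. k < N \<and> x k \<le> real m' / real K})"
          using elim[rule_format, unfolded atMost_iff, of m'] \<open>m \<le> K\<close> m' by linarith
        also have "card {k. k < N \<and> x k \<le> real m' / real K} \<le> lex_rank x N i"
          unfolding lex_rank_def
        proof (intro card_mono subsetI CollectI conjI disjI1)
          fix k assume k: "k \<in> {k. k < N \<and> x k \<le> real m' / real K}"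
          have "real m' / real K < x i" using m(2) K by (simp add: m' field_simps)
          with k show "k < N" "x k < x i" by auto
        qed simp
        finally show ?thesis using K N by (simp add: divide_right_mono)
      qed
      from upper lower show "\<bar>real (lex_rank x N i) / real N - x i\<bar> \<le> \<eta>" by linarith
    qed
  qed
qed

section \<open>Exchanging equal subintervals\<close>

abbreviation cell :: "nat \<Rightarrow> nat \<Rightarrow> real set" where
  "cell N i \<equiv> {real i / real N ..< (real i + 1) / real N}"

abbreviation cell_index :: "nat \<Rightarrow> real \<Rightarrow> nat" where
  "cell_index N u \<equiv> nat \<lfloor>real N * u\<rfloor>"

lemma mem_cell_iff:
  assumes "N > 0"
  shows "u \<in> cell N i \<longleftrightarrow> 0 \<le> u \<and> cell_index N u = i"
proof
  assume u: "u \<in> cell N i"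
  then have "real i \<le> real N * u" "real N * u < real i + 1"
    using assms by (auto simp: field_simps)
  moreover have "0 \<le> u" using u by (auto intro: order_trans[rotated])
  ultimately show "0 \<le> u \<and> cell_index N u = i" by (simp add: floor_unique[of "int i"])
next
  assume u: "0 \<le> u \<and> cell_index N u = i"
  then have "real i = of_int \<lfloor>real N * u\<rfloor>" by auto
  then have "real i \<le> real N * u" "real N * u < real i + 1" by linarith+
  then show "u \<in> cell N i" using assms by (auto simp: field_simps)
qed

lemma cell_index_less: "u \<in> {0..<1} \<Longrightarrow> N > 0 \<Longrightarrow> cell_index N u < N"
  by (simp add: nat_less_iff floor_less_iff)

lemma UN_cells: "N > 0 \<Longrightarrow> (\<Union>i<N. cell N i) = {0..<1}"
proof safe
  fix u i assume *: "N > 0" "i < N" "u \<in> cell N i"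
  have "u < (real i + 1) / real N" using * by simp
  also have "\<dots> \<le> 1" using * by simp
  finally show "u \<in> {0..<1}" using mem_cell_iff[OF *(1), of u i] * by simp
next
  fix u :: real assume *: "N > 0" "u \<in> {0..<1}"
  then have "u \<in> cell N (cell_index N u)" unfolding mem_cell_iff[OF *(1)] by simp
  then show "u \<in> (\<Union>i<N. cell N i)" using cell_index_less[OF *(2,1)] by blast
qed

lemma emeasure_lborel_sum_cells:
  assumes "N > 0" "A \<in> sets borel"
  shows "emeasure lborel (A \<inter> {0..<1}) = (\<Sum>i<N. emeasure lborel (A \<inter> cell N i))"
proof -
  have "disjoint_family_on (\<lambda>i. A \<inter> cell N i) {..<N}"
    by (auto simp: disjoint_family_on_def mem_cell_iff[OF assms(1)] simp del: atLeastLessThan_iff)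
  then have "(\<Sum>i<N. emeasure lborel (A \<inter> cell N i)) = emeasure lborel (\<Union>i<N. A \<inter> cell N i)"
    using assms(2) by (intro sum_emeasure) auto
  also have "(\<Union>i<N. A \<inter> cell N i) = A \<inter> {0..<1}"
    using UN_cells[OF assms(1)] by blast
  finally show ?thesis by simp
qed

text \<open>
  The map that translates the \<open>i\<close>-th of \<open>N\<close> equal subintervals of \<open>[0, 1)\<close> onto the \<open>\<sigma> i\<close>-th.
\<close>
definition interval_exchange :: "nat \<Rightarrow> (nat \<Rightarrow> nat) \<Rightarrow> real \<Rightarrow> real" where
  "interval_exchange N \<sigma> u = u + (real (\<sigma> (cell_index N u)) - real (cell_index N u)) / real N"

lemma interval_exchange_mem:
  assumes "N > 0" "u \<in> {0..<1}"
  shows "interval_exchange N \<sigma> u \<in> cell N (\<sigma> (cell_index N u))"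
proof -
  have "u \<in> cell N (cell_index N u)"
    unfolding mem_cell_iff[OF assms(1)] using assms(2) by simp
  then show ?thesis by (auto simp: interval_exchange_def diff_divide_distrib add_divide_distrib)
qed

lemma borel_measurable_interval_exchange [measurable]: "interval_exchange N \<sigma> \<in> borel_measurable borel"
  unfolding interval_exchange_def by measurable

lemma interval_exchange_mem_unit:
  assumes "bij_betw \<sigma> {..<N} {..<N}" "N > 0" "u \<in> {0..<1}"
  shows "interval_exchange N \<sigma> u \<in> {0..<1}"
proof -
  have "\<sigma> (cell_index N u) < N"
    using assms cell_index_less[OF assms(3,2)] by (auto simp: bij_betw_def)
  then show ?thesis using interval_exchange_mem[OF assms(2,3)] UN_cells[OF assms(2)] by blast
qed

text \<open>
  Without the endpoint 1 the \<open>N\<close> cells are an exact partition; the endpoint has measure zero.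
\<close>
abbreviation uniform01 :: "real measure" where
  "uniform01 \<equiv> restrict_space lborel {0..<1}"

lemma prob_space_uniform01: "prob_space uniform01"
  by (rule prob_spaceI) (simp add: emeasure_restrict_space space_restrict_space)

text \<open>
  A permutation of the cells by translations preserves Lebesgue measure: split a set along the
  cells, translate each part, and reorder the sum.
\<close>
lemma distr_interval_exchange:
  assumes \<sigma>: "bij_betw \<sigma> {..<N} {..<N}" and N: "N > 0"
  shows "distr uniform01 (restrict_space borel {0..1}) (interval_exchange N \<sigma>) =
    restrict_space lborel {0..1}"
proof (rule measure_eqI)
  show "sets (distr uniform01 (restrict_space borel {0..1}) (interval_exchange N \<sigma>)) =
    sets (restrict_space lborel {0..1})"
    by (simp cong: sets_restrict_space_cong)
next
  let ?T = "interval_exchange N \<sigma>"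
  have meas: "?T \<in> measurable uniform01 (restrict_space borel {0..1})"
  proof (rule measurable_restrict_space2)
    show "?T \<in> space uniform01 \<rightarrow> {0..1}"
      using interval_exchange_mem_unit[OF \<sigma> N] by (force simp: space_restrict_space)
    show "?T \<in> borel_measurable uniform01"
      by (intro measurable_restrict_space1) simp
  qed
  fix A assume "A \<in> sets (distr uniform01 (restrict_space borel {0..1}) ?T)"
  then have A: "A \<in> sets (restrict_space borel {0..1})" by simp
  then have A_borel [measurable]: "A \<in> sets borel" and A_sub: "A \<subseteq> {0..1}"
    by (auto simp: sets_restrict_space_iff)
  have "emeasure (distr uniform01 (restrict_space borel {0..1}) ?T) A =
      emeasure uniform01 (?T -` A \<inter> {0..<1})"
    using emeasure_distr[OF meas A] by (simp add: space_restrict_space)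
  also have "\<dots> = emeasure lborel (?T -` A \<inter> {0..<1})"
    by (subst emeasure_restrict_space) auto
  also have "\<dots> = (\<Sum>i<N. emeasure lborel (?T -` A \<inter> cell N i))"
    using measurable_sets[OF borel_measurable_interval_exchange A_borel]
    by (intro emeasure_lborel_sum_cells N) simp
  also have "\<dots> = (\<Sum>i<N. emeasure lborel (A \<inter> cell N (\<sigma> i)))"
  proof (intro sum.cong refl)
    fix i
    let ?c = "(real (\<sigma> i) - real i) / real N"
    have "?T -` A \<inter> cell N i = (+) ?c -` (A \<inter> cell N (\<sigma> i))"
    proof (intro set_eqI)
      fix u
      have "u \<in> cell N i \<longleftrightarrow> ?c + u \<in> cell N (\<sigma> i)" 
        by (auto simp: diff_divide_distrib add_divide_distrib)
      moreover have "?T u = ?c + u" if "u \<in> cell N i"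
        using that mem_cell_iff[OF N, of u i] by (simp add: interval_exchange_def)
      ultimately show "u \<in> ?T -` A \<inter> cell N i \<longleftrightarrow> u \<in> (+) ?c -` (A \<inter> cell N (\<sigma> i))"
        by auto
    qed
    also have "emeasure lborel \<dots> = emeasure (distr lborel borel ((+) ?c)) (A \<inter> cell N (\<sigma> i))"
      by (subst emeasure_distr) auto
    finally show "emeasure lborel (?T -` A \<inter> cell N i) = emeasure lborel (A \<inter> cell N (\<sigma> i))"
      by (simp add: lborel_distr_plus)
  qed
  also have "\<dots> = (\<Sum>i<N. emeasure lborel (A \<inter> cell N i))"
    by (rule sum.reindex_bij_betw[OF \<sigma>])
  also have "\<dots> = emeasure lborel (A \<inter> {0..<1})"
    by (rule emeasure_lborel_sum_cells[OF N A_borel, symmetric])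
  also have "A \<inter> {0..<1} = A - {1}" using A_sub by force
  also have "emeasure lborel (A - {1}) = emeasure lborel A"
    by (rule emeasure_Diff_null_set) (auto simp: null_sets_def)
  also have "\<dots> = emeasure (restrict_space lborel {0..1}) A"
    using A_sub by (simp add: emeasure_restrict_space)
  finally show "emeasure (distr uniform01 (restrict_space borel {0..1}) ?T) A =
      emeasure (restrict_space lborel {0..1}) A" .
qed

lemma integral_cell_index:
  fixes g :: "nat \<Rightarrow> real"
  assumes "N > 0"
  shows "(\<integral>u. g (cell_index N u) \<partial>uniform01) = 1 / real N * (\<Sum>i<N. g i)"
proof -
  interpret prob_space uniform01 by (rule prob_space_uniform01)
  have sub: "cell N i \<subseteq> {0..<1}" if "i < N" for i using UN_cells[OF assms] that by blast
  have meas: "cell N i \<in> sets uniform01" if "i < N" for i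
    using sub[OF that] by (simp add: sets_restrict_space_iff)
  have int: "integrable uniform01 (indicator (cell N i) :: real \<Rightarrow> real)" if "i < N" for i
    using meas[OF that] by (intro integrable_real_indicator) (auto simp: less_top[symmetric])
  have "(\<integral>u. g (cell_index N u) \<partial>uniform01) =
      (\<integral>u. (\<Sum>i<N. g i * indicator (cell N i) u) \<partial>uniform01)"
  proof (intro Bochner_Integration.integral_cong refl)
    fix u assume "u \<in> space uniform01"
    then have u: "u \<in> {0..<1}" by (simp add: space_restrict_space)
    have "(\<Sum>i<N. g i * indicator (cell N i) u) = (\<Sum>i<N. if i = cell_index N u then g i else 0)"
      using mem_cell_iff[OF assms, of u] u by (intro sum.cong) (auto simp: indicator_def)
    then show "g (cell_index N u) = (\<Sum>i<N. g i * indicator (cell N i) u)"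
      using cell_index_less[OF u assms] by simp
  qed
  also have "\<dots> = (\<Sum>i<N. \<integral>u. g i * indicator (cell N i) u \<partial>uniform01)"
    using int by (intro Bochner_Integration.integral_sum integrable_mult_right) simp
  also have "\<dots> = (\<Sum>i<N. g i * measure uniform01 (cell N i))"
    using meas by (intro sum.cong refl) (simp add: sets.Int_space_eq2)
  also have "\<dots> = (\<Sum>i<N. g i * (1 / real N))"
  proof (intro sum.cong refl)
    fix i assume "i \<in> {..<N}"
    then have "measure uniform01 (cell N i) = measure lborel (cell N i)"
      using sub by (intro measure_restrict_space) auto
    also have "\<dots> = 1 / real N"
      using assms by (simp add: divide_right_mono field_simps)
    finally show "g i * measure uniform01 (cell N i) = g i * (1 / real N)" by simp
  qed
  finally show ?thesis by (simp add: sum_distrib_left sum_divide_distrib)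
qed

section \<open>From sequences to measures\<close>

text \<open>
  Driving all coordinates by one uniform variable gives a \<open>d\<close>-stochastic measure, since each
  coordinate map preserves Lebesgue measure.
\<close>
lemma
  fixes \<sigma> :: "'d::finite \<Rightarrow> nat \<Rightarrow> nat"
  assumes \<sigma>: "\<And>j. bij_betw (\<sigma> j) {..<N} {..<N}" and N: "N > 0"
  defines "T \<equiv> \<lambda>u. \<chi> j. interval_exchange N (\<sigma> j) u"
  shows measurable_exchange_coupling: "T \<in> measurable uniform01 (restrict_space borel unit_cube)"
    and d_stochastic_exchange_coupling: "d_stochastic (distr uniform01 (restrict_space borel unit_cube) T)"
proof -
  show meas: "T \<in> measurable uniform01 (restrict_space borel unit_cube)"
  proof (rule measurable_restrict_space2)
    have "T u \<in> unit_cube" if "u \<in> {0..<1}" for u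
      using interval_exchange_mem_unit[OF \<sigma> N that] by (auto simp: T_def mem_box_cart less_imp_le)
    then show "T \<in> space uniform01 \<rightarrow> unit_cube" by (auto simp: space_restrict_space)
    have "T \<in> borel_measurable borel"
      unfolding T_def borel_measurable_euclidean_space[where 'c = "real ^ 'd"]
      by (auto simp: Basis_vec_def inner_axis)
    then show "T \<in> borel_measurable uniform01"
      by (intro measurable_restrict_space1) simp
  qed
  interpret prob_space uniform01 by (rule prob_space_uniform01)
  have coord: "(\<lambda>x. x $ j) \<in> measurable (restrict_space borel unit_cube) (restrict_space borel {0..1})"
    for j :: 'd
    by (rule measurable_restrict_space2)
      (auto simp: space_restrict_space mem_box_cart
        intro!: borel_measurable_continuous_on_restrict continuous_intros)
  show "d_stochastic (distr uniform01 (restrict_space borel unit_cube) T)"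
    unfolding d_stochastic_def
  proof (intro conjI allI)
    show "prob_space (distr uniform01 (restrict_space borel unit_cube) T)"
      by (rule prob_space_distr[OF meas])
    fix j
    have "(\<lambda>x. x $ j) \<circ> T = interval_exchange N (\<sigma> j)" by (simp add: T_def o_def)
    then show "distr (distr uniform01 (restrict_space borel unit_cube) T)
        (restrict_space borel {0..1}) (\<lambda>x. x $ j) = restrict_space lborel {0..1}"
      by (simp add: distr_distr[OF coord meas] distr_interval_exchange[OF \<sigma> N])
  qed simp
qed

text \<open>
  The empirical measure of the first \<open>N\<close> points need not be \<open>d\<close>-stochastic. Replacing each
  coordinate by its rank divided by \<open>N\<close>, and each point by mass \<open>1/N\<close> spread over the diagonal of a
  cube of side \<open>1/N\<close>, makes the marginals exactly uniform. For large \<open>N\<close> this moves the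
  mass only slightly, and \<open>f\<close> is uniformly continuous.
\<close>
lemma ex_d_stochastic_near_average:
  fixes f :: "real ^ 'd::finite \<Rightarrow> real" and x :: "'d \<Rightarrow> nat \<Rightarrow> real"
  assumes cont: "continuous_on unit_cube f" and x: "\<And>j. uniformly_distributed (x j)"
    and "\<epsilon> > 0"
  shows "\<forall>\<^sub>F N in sequentially. \<exists>\<theta>. d_stochastic \<theta> \<and>
    1 / real N * (\<Sum>i<N. f (\<chi> j. x j i)) \<le> integral\<^sup>L \<theta> f + \<epsilon>"
proof -
  interpret prob_space uniform01 by (rule prob_space_uniform01)
  define X where "X i = (\<chi> j. x j i)" for i
  have X: "X i \<in> unit_cube" for i
    using x by (auto simp: X_def mem_box_cart uniformly_distributed_def image_subset_iff)
  obtain B where B: "\<And>y. y \<in> unit_cube \<Longrightarrow> \<bar>f y\<bar> \<le> B"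
    using continuous_on_unit_cube_bounded[OF cont] by blast
  obtain \<delta> where "\<delta> > 0"
    and \<delta>: "\<And>y z. y \<in> unit_cube \<Longrightarrow> z \<in> unit_cube \<Longrightarrow> dist z y < \<delta> \<Longrightarrow> dist (f z) (f y) < \<epsilon>"
    using compact_uniformly_continuous[OF cont compact_cbox] \<open>\<epsilon> > 0\<close>
    unfolding uniformly_continuous_on_def by metis
  \<comment> \<open>Each coordinate will be off by at most \<open>2 * \<eta>\<close>: \<open>\<eta>\<close> from the rank and \<open>1/N < \<eta>\<close> from the cell.\<close>
  define \<eta> where "\<eta> = \<delta> / (3 * real CARD('d))"
  have "\<eta> > 0" using \<open>\<delta> > 0\<close> by (simp add: \<eta>_def)
  have "\<forall>\<^sub>F N in sequentially. \<forall>j. \<forall>i<N. \<bar>real (lex_rank (x j) N i) / real N - x j i\<bar> \<le> \<eta>"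
    by (intro eventually_all_finite lex_rank_approximates x \<open>\<eta> > 0\<close>)
  moreover have "\<forall>\<^sub>F N in sequentially. 1 / real N < \<eta>"
    by (rule order_tendstoD(2)[OF lim_1_over_n \<open>\<eta> > 0\<close>])
  moreover have "\<forall>\<^sub>F N :: nat in sequentially. N > 0" by (rule eventually_gt_at_top)
  ultimately show ?thesis
  proof eventually_elim
    case (elim N)
    note N = elim(3)
    define T where "T u = (\<chi> j. interval_exchange N (lex_rank (x j) N) u)" for u
    have meas: "T \<in> measurable uniform01 (restrict_space borel unit_cube)"
      unfolding T_def by (rule measurable_exchange_coupling[OF bij_betw_lex_rank N])
    define \<theta> where "\<theta> = distr uniform01 (restrict_space borel unit_cube) T"
    have \<theta>: "d_stochastic \<theta>"
      unfolding \<theta>_def T_def by (rule d_stochastic_exchange_coupling[OF bij_betw_lex_rank N])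
    have T_space: "T u \<in> unit_cube" if "u \<in> space uniform01" for u
      using measurable_space[OF meas that] by (simp add: space_restrict_space)
    have close: "f (X (cell_index N u)) - \<epsilon> \<le> f (T u)" if u: "u \<in> space uniform01" for u
    proof -
      have u': "u \<in> {0..<1}" using u by (simp add: space_restrict_space)
      let ?i = "cell_index N u"
      have i: "?i < N" by (rule cell_index_less[OF u' N])
      have "dist (T u) (X ?i) \<le> (\<Sum>j\<in>UNIV. \<bar>(T u - X ?i) $ j\<bar>)"
        unfolding dist_norm by (rule norm_le_l1_cart)
      also have "\<dots> \<le> (\<Sum>j\<in>(UNIV::'d set). 2 * \<eta>)"
      proof (rule sum_mono)
        fix j :: 'd
        let ?r = "lex_rank (x j) N ?i"
        have "interval_exchange N (lex_rank (x j) N) u \<in> cell N ?r"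
          by (rule interval_exchange_mem[OF N u'])
        then have "\<bar>T u $ j - real ?r / real N\<bar> \<le> 1 / real N"
          by (simp add: T_def add_divide_distrib)
        moreover have "\<bar>real ?r / real N - x j ?i\<bar> \<le> \<eta>" using elim(1) i by blast
        ultimately show "\<bar>(T u - X ?i) $ j\<bar> \<le> 2 * \<eta>"
          using elim(2) by (simp add: X_def)
      qed
      also have "\<dots> < \<delta>" using \<open>\<delta> > 0\<close> by (simp add: \<eta>_def)
      finally have "dist (f (T u)) (f (X ?i)) < \<epsilon>" by (intro \<delta> X T_space u)
      then show ?thesis by (simp add: dist_real_def abs_less_iff)
    qed
    have f_meas: "f \<in> borel_measurable (restrict_space borel unit_cube)"
      using cont by (rule borel_measurable_continuous_on_restrict)
    have "1 / real N * (\<Sum>i<N. f (X i)) - \<epsilon> = 1 / real N * (\<Sum>i<N. f (X i) - \<epsilon>)"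
      using N by (simp add: sum_subtractf field_simps)
    also have "\<dots> = (\<integral>u. f (X (cell_index N u)) - \<epsilon> \<partial>uniform01)"
      by (rule integral_cell_index[OF N, symmetric])
    also have "\<dots> \<le> (\<integral>u. f (T u) \<partial>uniform01)"
    proof (rule integral_mono)
      show "integrable uniform01 (\<lambda>u. f (X (cell_index N u)) - \<epsilon>)"
      proof (rule integrable_const_bound[of _ "B + \<epsilon>"])
        show "AE u in uniform01. norm (f (X (cell_index N u)) - \<epsilon>) \<le> B + \<epsilon>"
          using B[OF X] \<open>\<epsilon> > 0\<close> by (intro AE_I2) (simp add: abs_le_iff, smt (verit))
        show "(\<lambda>u. f (X (cell_index N u)) - \<epsilon>) \<in> borel_measurable uniform01"
          by (intro measurable_restrict_space1) simp
      qed
      show "integrable uniform01 (\<lambda>u. f (T u))"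
        using B[OF T_space] measurable_compose[OF meas f_meas]
        by (intro integrable_const_bound[of _ B]) (auto intro!: AE_I2)
    qed (rule close)
    also have "\<dots> = integral\<^sup>L \<theta> f"
      unfolding \<theta>_def by (rule integral_distr[OF meas f_meas, symmetric])
    finally show ?case using \<theta> by (auto simp: X_def intro!: exI[of _ \<theta>])
  qed
qed

section \<open>Equality of the suprema\<close>

theorem lemma3p2:
  fixes f :: "real ^ 'd::finite \<Rightarrow> real"
  assumes "CARD('d) \<ge> 2"
    and "continuous_on unit_cube f"
  shows "(SUP x \<in> {x :: 'd \<Rightarrow> nat \<Rightarrow> real. \<forall>j. x j \<in> UD}.
            limsup (\<lambda>n. ereal (1 / real n * (\<Sum>i<n. f (\<chi> j. x j i)))))
       = (SUP \<theta> \<in> P_ds. ereal (integral\<^sup>L \<theta> f))"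
    (is "?L = ?R")
proof (rule antisym)
  show "?L \<le> ?R"
  proof (rule SUP_least)
    fix x :: "'d \<Rightarrow> nat \<Rightarrow> real"
    assume "x \<in> {x. \<forall>j. x j \<in> UD}"
    then have x: "uniformly_distributed (x j)" for j by (simp add: UD_def)
    show "limsup (\<lambda>n. ereal (1 / real n * (\<Sum>i<n. f (\<chi> j. x j i)))) \<le> ?R"
    proof (rule ereal_le_epsilon2)
      fix \<epsilon> :: real assume "0 < \<epsilon>"
      show "limsup (\<lambda>n. ereal (1 / real n * (\<Sum>i<n. f (\<chi> j. x j i)))) \<le> ?R + ereal \<epsilon>"
      proof (rule Limsup_bounded)
        have "\<forall>\<^sub>F n in sequentially. \<exists>\<theta>. d_stochastic \<theta> \<and>
            1 / real n * (\<Sum>i<n. f (\<chi> j. x j i)) \<le> integral\<^sup>L \<theta> f + \<epsilon>"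
          by (intro ex_d_stochastic_near_average assms(2) x \<open>0 < \<epsilon>\<close>)
        then show "\<forall>\<^sub>F n in sequentially. ereal (1 / real n * (\<Sum>i<n. f (\<chi> j. x j i))) \<le> ?R + ereal \<epsilon>"
        proof eventually_elim
          case (elim n)
          then obtain \<theta> where "\<theta> \<in> P_ds"
            and le: "1 / real n * (\<Sum>i<n. f (\<chi> j. x j i)) \<le> integral\<^sup>L \<theta> f + \<epsilon>"
            by (auto simp: P_ds_def)
          have "ereal (1 / real n * (\<Sum>i<n. f (\<chi> j. x j i))) \<le> ereal (integral\<^sup>L \<theta> f) + ereal \<epsilon>"
            using le by simp
          also have "\<dots> \<le> ?R + ereal \<epsilon>"
            using \<open>\<theta> \<in> P_ds\<close> by (intro add_right_mono SUP_upper)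
          finally show ?case .
        qed
      qed
    qed
  qed
  show "?R \<le> ?L"
  proof (rule SUP_least)
    fix \<theta> :: "(real ^ 'd) measure" assume "\<theta> \<in> P_ds"
    then have "d_stochastic \<theta>" by (simp add: P_ds_def)
    from ex_uniformly_distributed_averages_converge[OF assms(2) this]
    obtain x where "\<forall>j. x j \<in> UD"
      and lim: "(\<lambda>n. 1 / real n * (\<Sum>i<n. f (\<chi> j. x j i))) \<longlonglongrightarrow> integral\<^sup>L \<theta> f" by blast
    have "limsup (\<lambda>n. ereal (1 / real n * (\<Sum>i<n. f (\<chi> j. x j i)))) = ereal (integral\<^sup>L \<theta> f)"
      using lim by (intro lim_imp_Limsup) auto
    with \<open>\<forall>j. x j \<in> UD\<close> show "ereal (integral\<^sup>L \<theta> f) \<le> ?L"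
      by (intro SUP_upper2[of x]) auto
  qed
qed

end
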